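(* For every $x\in\mathcal M^B$, the linear operator $$P_x^B:=P_x-P_xB^*L_x^{-1}BP_x$$ on $\mathcal E$ is a projection operator onto $T_x\mathcal M^B$. Specifically, $P_x^Bu\in T_x\mathcal M^B$ for all $u\in\mathcal E$, and $P_x^Bv=v$ for all $v\in T_x\mathcal M^B$. Furthermore, if $P_x$ is an orthogonal projection, then $P_x^B$ is also an orthogonal projection.
   Context: $\mathcal E,\mathcal Y$ are real Hilbert spaces. $\mathcal M\subset\mathcal E$ is a $C^2$ embedded submanifold; for $x\in\mathcal M$ the tangent space $T_x\mathcal M$ is identified with a closed linear subspace of $\mathcal E$. $B:\mathcal E\to\mathcal Y$ is a surjective bounded linear operator with adjoint $B^*$, $c\in\mathcal Y$, and $\mathcal M^B:=\{x\in\mathcal M: Bx=c\}$ is nonempty. For each $x\in\mathcal M$ a bounded linear projection $P_x:\mathcal E\to T_x\mathcal M$ onto $T_x\mathcal M$ is given (not necessarily orthogonal). A linear operator $F$ from $\mathcal E$ to a closed subspace is called a projection onto it if it is surjective onto that subspace and $F^2=F$. Standing assumption: for every $x\in\mathcal M^B$, $L_x:=BP_xB^*:\mathcal Y\to\mathcal Y$ is invertible. Then $\mathcal M^B$ is a $C^2$ Hilbert submanifold with $T_x\mathcal M^B=T_x\mathcal M\cap\ker B$. *)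

theory Defs
  imports "HOL-Analysis.Analysis"
begin

text \<open>Real Hilbert spaces are types of sort \<open>{real_inner, banach}\<close>.\<close>

definition C2_on :: "'a::real_normed_vector set \<Rightarrow> ('a \<Rightarrow> 'b::real_normed_vector) \<Rightarrow> bool" where
  "C2_on U f \<longleftrightarrow>
     open U \<and>
     (\<exists>(f' :: 'a \<Rightarrow> 'a \<Rightarrow>\<^sub>L 'b) (f'' :: 'a \<Rightarrow> 'a \<Rightarrow>\<^sub>L 'a \<Rightarrow>\<^sub>L 'b).
        (\<forall>x\<in>U. (f has_derivative blinfun_apply (f' x)) (at x)) \<and>
        (\<forall>x\<in>U. (f' has_derivative blinfun_apply (f'' x)) (at x)) \<and>
        continuous_on U f'')"

text \<open>
  Local flattening: near each of its points, \<open>M\<close> is carried onto an open piece of a closed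
  linear subspace \<open>W\<close> by a \<open>C\<^sup>2\<close> diffeomorphism between open subsets of the ambient space.
  As usual for manifolds modelled on Hilbert spaces, \<open>W\<close> may vary with the point; it is
  complemented automatically because the ambient space is a Hilbert space.
\<close>

definition C2_embedded_submanifold :: "'a::{real_inner,banach} set \<Rightarrow> bool" where
  "C2_embedded_submanifold M \<longleftrightarrow>
     (\<forall>x\<in>M. \<exists>(U :: 'a set) (V :: 'a set) \<phi> \<psi> W.
        open U \<and> x \<in> U \<and> open V \<and>
        homeomorphism U V \<phi> \<psi> \<and> C2_on U \<phi> \<and> C2_on V \<psi> \<and>
        subspace W \<and> closed W \<and>
        \<phi> ` (U \<inter> M) = V \<inter> W)"

text \<open>
  The tangent space as a subset of the ambient space: velocities at \<open>x\<close> of \<open>C\<^sup>1\<close> curves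
  that stay in \<open>M\<close>. The definition makes sense for any set \<open>M\<close>; it is a closed linear
  subspace when \<open>M\<close> is an embedded submanifold and \<open>x \<in> M\<close>.
\<close>

definition tangent_space :: "'a::real_normed_vector set \<Rightarrow> 'a \<Rightarrow> 'a set" where
  "tangent_space M x =
     {v. \<exists>(\<gamma> :: real \<Rightarrow> 'a) \<gamma>' \<epsilon>. \<epsilon> > 0 \<and>
           (\<forall>t\<in>{-\<epsilon><..<\<epsilon>}. \<gamma> t \<in> M \<and> (\<gamma> has_vector_derivative \<gamma>' t) (at t)) \<and>
           continuous_on {-\<epsilon><..<\<epsilon>} \<gamma>' \<and>
           \<gamma> 0 = x \<and> \<gamma>' 0 = v}"

definition constrained_set :: "'e set \<Rightarrow> ('e \<Rightarrow> 'y) \<Rightarrow> 'y \<Rightarrow> 'e set" where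
  "constrained_set M B c = {x \<in> M. B x = c}"

definition projection_onto :: "('a::real_normed_vector \<Rightarrow> 'a) \<Rightarrow> 'a set \<Rightarrow> bool" where
  "projection_onto F S \<longleftrightarrow>
     subspace S \<and> closed S \<and> linear F \<and> range F = S \<and> F \<circ> F = F"

definition orthogonal_projection_onto :: "('a::real_inner \<Rightarrow> 'a) \<Rightarrow> 'a set \<Rightarrow> bool" where
  "orthogonal_projection_onto F S \<longleftrightarrow>
     projection_onto F S \<and> (\<forall>u. \<forall>s\<in>S. orthogonal (u - F u) s)"

text \<open>
  Invertibility in the operator sense, with a bounded inverse. For a bounded operator on a
  Banach space this is the same as bijectivity, by the bounded inverse theorem.
\<close>

definition invertible_operator :: "('a::real_normed_vector \<Rightarrow> 'a) \<Rightarrow> bool" where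
  "invertible_operator L \<longleftrightarrow>
     bounded_linear L \<and> (\<exists>K. bounded_linear K \<and> K \<circ> L = id \<and> L \<circ> K = id)"

text \<open>
  In the next two definitions \<open>P\<close> stands for the projection at one fixed point. The library's
  \<open>adjoint\<close> is chosen by its defining identity, so it is the Hilbert space adjoint when \<open>B\<close>
  is a bounded operator between Hilbert spaces.
\<close>

definition L_op :: "('e::real_inner \<Rightarrow> 'y::real_inner) \<Rightarrow> ('e \<Rightarrow> 'e) \<Rightarrow> 'y \<Rightarrow> 'y" where
  "L_op B P = B \<circ> P \<circ> adjoint B"

definition constrained_projection ::
    "('e::real_inner \<Rightarrow> 'y::real_inner) \<Rightarrow> ('e \<Rightarrow> 'e) \<Rightarrow> 'e \<Rightarrow> 'e" where
  "constrained_projection B P = (\<lambda>u. P u - P (adjoint B (inv (L_op B P) (B (P u)))))"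

end

theory Submission
  imports Defs
begin

text \<open>
  Fix \<open>x\<close> in \<open>M\<^sup>B\<close>, the set \<open>constrained_set M B c\<close>, and put \<open>R = P\<^sub>x B\<^sup>* L\<^sub>x\<^sup>-\<^sup>1\<close>. By the definition of
  \<open>L\<^sub>x\<close> this is a bounded right inverse of \<open>B\<close> with values in \<open>T\<^sub>x M\<close>, and the constrained
  projection is \<open>u \<mapsto> P\<^sub>x u - R (B (P\<^sub>x u))\<close>: project to \<open>T\<^sub>x M\<close>, then subtract the vector of
  \<open>T\<^sub>x M\<close> that carries the unwanted value of \<open>B\<close>. It therefore maps into
  \<open>T\<^sub>x M \<inter> ker B\<close> and fixes that subspace. If \<open>P\<^sub>x\<close> is orthogonal and \<open>s \<in> T\<^sub>x M \<inter> ker B\<close>, then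
  \<open>\<langle>P\<^sub>x B\<^sup>* z, s\<rangle> = \<langle>B\<^sup>* z, s\<rangle> = \<langle>z, B s\<rangle> = 0\<close>, so the correction is orthogonal to \<open>s\<close> as well.

  The substance is the identity \<open>T\<^sub>x M\<^sup>B = T\<^sub>x M \<inter> ker B\<close> for spaces of velocities of curves,
  lemma \<open>tangent_space_constrained_set\<close>. One inclusion differentiates \<open>B \<gamma> = c\<close>. For the other,
  a chart turns \<open>M\<close> into a closed subspace \<open>W\<close>. In the chart the constraint map has a derivative
  with a bounded right inverse into \<open>W\<close>, namely the image of \<open>R\<close>; so a straight line with
  direction in \<open>W\<close> and in the kernel of that derivative can be bent, within \<open>W\<close>, into a curve
  that satisfies the constraint. This bending is lemma \<open>submersion_level_curve\<close>, a
  one-parameter implicit function theorem in Banach spaces.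

  Boundedness of \<open>R\<close>, and the computation in the orthogonal case, need the adjoint of \<open>B\<close> to
  satisfy its defining identity. In infinite dimension this rests on the Riesz representation
  theorem and hence on completeness.
\<close>

section \<open>Adjoints of bounded operators between Hilbert spaces\<close>

text \<open>
  The representing vector minimises the energy \<open>J x = \<langle>x, x\<rangle> - 2 f x\<close>. By the parallelogram law
  a minimising sequence is Cauchy, and at the minimum the first variation
  \<open>2 (\<langle>h, a\<rangle> - f h)\<close> vanishes in every direction \<open>h\<close>.
\<close>

lemma riesz_representation:
  fixes f :: "'a::{real_inner,banach} \<Rightarrow> real"
  assumes "bounded_linear f"
  obtains a where "\<And>x. f x = x \<bullet> a"
proof -
  interpret f: bounded_linear f by fact
  define J where "J x = x \<bullet> x - 2 * f x" for x
  obtain K where K: "\<And>x. norm (f x) \<le> norm x * K" "K > 0"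
    using f.pos_bounded by blast
  have "- (K\<^sup>2) \<le> J x" for x
  proof -
    have "f x \<le> norm x * K" using K(1)[of x] by auto
    moreover have "0 \<le> (norm x - K)\<^sup>2" by simp
    ultimately show ?thesis
      by (auto simp: J_def power2_eq_square algebra_simps dot_square_norm)
  qed
  then have bdd: "bdd_below (range J)" by (auto intro!: bdd_belowI)
  define m where "m = Inf (range J)"
  have m_le: "m \<le> J x" for x unfolding m_def using bdd by (auto intro!: cInf_lower)
  have "\<exists>x. J x < m + inverse (Suc n)" for n
    using cInf_lessD[of "range J" "m + inverse (Suc n)"] by (auto simp: m_def)
  then obtain X where X: "\<And>n. J (X n) < m + inverse (Suc n)" by metis
  have par: "(norm (x - y))\<^sup>2 \<le> 2 * (J x - m) + 2 * (J y - m)" for x y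
  proof -
    define z where "z = (1/2) *\<^sub>R (x + y)"
    have "(norm (x - y))\<^sup>2 = 2 * J x + 2 * J y - 4 * J z"
      by (simp add: z_def J_def power2_norm_eq_inner inner_diff_left inner_diff_right inner_add_left
          inner_add_right f.add f.scaleR inner_commute field_simps)
    then show ?thesis using m_le[of z] by argo
  qed
  have "Cauchy X"
  proof (rule metric_CauchyI)
    fix e :: real assume "e > 0"
    then obtain N where N: "N > 0" "inverse (real N) < e\<^sup>2 / 4"
      by (metis real_arch_inverse less_divide_eq_numeral1(1) mult_zero_left zero_less_power neq0_conv)
    show "\<exists>M. \<forall>p\<ge>M. \<forall>n\<ge>M. dist (X p) (X n) < e"
    proof (intro exI allI impI)
      fix p n assume pn: "p \<ge> N" "n \<ge> N"
      have *: "inverse (real (Suc k)) < e\<^sup>2 / 4" if "k \<ge> N" for k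
        using N that by (smt (verit) le_imp_inverse_le of_nat_0_less_iff of_nat_le_iff of_nat_Suc)
      have "(norm (X p - X n))\<^sup>2 < e\<^sup>2"
        using par[of "X p" "X n"] X[of p] X[of n] *[OF pn(1)] *[OF pn(2)] by argo
      then show "dist (X p) (X n) < e"
        using \<open>e > 0\<close> by (simp add: dist_norm power_less_imp_less_base)
    qed
  qed
  then obtain a where a: "X \<longlonglongrightarrow> a"
    using Cauchy_convergent convergent_def by blast
  have "(\<lambda>n. J (X n)) \<longlonglongrightarrow> J a"
    unfolding J_def by (intro tendsto_intros f.tendsto a)
  moreover have "(\<lambda>n. m + inverse (real (Suc n))) \<longlonglongrightarrow> m + 0"
    by (intro tendsto_intros LIMSEQ_inverse_real_of_nat)
  ultimately have "J a \<le> m + 0"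
    by (rule LIMSEQ_le) (use X in \<open>auto intro!: exI[of _ 0] less_imp_le\<close>)
  then have min: "J a \<le> J x" for x using m_le[of x] by linarith
  show ?thesis
  proof
    fix h
    define d where "d = h \<bullet> a - f h"
    have var: "0 \<le> 2 * t * d + t\<^sup>2 * (h \<bullet> h)" for t
    proof -
      have "J (a + t *\<^sub>R h) - J a = 2 * t * d + t\<^sup>2 * (h \<bullet> h)"
        by (simp add: J_def d_def inner_add_left inner_add_right f.add f.scaleR inner_commute
            power2_eq_square algebra_simps)
      with min[of "a + t *\<^sub>R h"] show ?thesis by linarith
    qed
    show "f h = h \<bullet> a"
    proof (cases "h = 0")
      case True then show ?thesis by (simp add: f.zero)
    next
      case False
      then have N: "h \<bullet> h > 0" by simp
      \<comment> \<open>The quadratic \<open>var\<close> in \<open>t\<close> is smallest at \<open>t = - d / \<langle>h, h\<rangle>\<close>.\<close>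
      have "2 * (- d / (h \<bullet> h)) * d + (- d / (h \<bullet> h))\<^sup>2 * (h \<bullet> h) = - (d\<^sup>2 / (h \<bullet> h))"
        using N by (simp add: field_simps power2_eq_square)
      with var[of "- d / (h \<bullet> h)"] have "d\<^sup>2 / (h \<bullet> h) \<le> 0" by linarith
      with N have "d\<^sup>2 = 0" by (metis zero_le_power2 divide_nonneg_pos divide_eq_0_iff less_irrefl order_antisym)
      then show ?thesis by (simp add: d_def)
    qed
  qed
qed

text \<open>
  \<open>adjoint\<close> is a choice operator, so the content is that some map with this property exists:
  \<open>adjoint B y\<close> represents the functional \<open>x \<mapsto> \<langle>B x, y\<rangle>\<close>.
\<close>

lemma adjoint_inner:
  fixes B :: "'e::{real_inner,banach} \<Rightarrow> 'y::real_inner"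
  assumes "bounded_linear B"
  shows "B x \<bullet> y = x \<bullet> adjoint B y"
proof -
  have "\<exists>a. \<forall>x. B x \<bullet> y = x \<bullet> a" for y
  proof -
    have "bounded_linear (\<lambda>x. B x \<bullet> y)"
      using bounded_linear_compose[OF bounded_linear_inner_left assms] .
    then show ?thesis by (metis riesz_representation)
  qed
  then have "\<exists>f'. \<forall>x y. B x \<bullet> y = x \<bullet> f' y" by metis
  then have "\<forall>x y. B x \<bullet> y = x \<bullet> adjoint B y"
    unfolding adjoint_def by (rule someI_ex)
  then show ?thesis by blast
qed

lemma bounded_linear_adjoint:
  fixes B :: "'e::{real_inner,banach} \<Rightarrow> 'y::real_inner"
  assumes "bounded_linear B"
  shows "bounded_linear (adjoint B)"
proof -
  interpret B: bounded_linear B by fact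
  note adj = adjoint_inner[OF assms, symmetric]
  obtain K where K: "\<And>x. norm (B x) \<le> norm x * K" "K > 0"
    using B.pos_bounded by blast
  show ?thesis
  proof (rule bounded_linear_intro[where K=K])
    show "adjoint B (x + y) = adjoint B x + adjoint B y" for x y
      by (rule vector_eq_ldot[THEN iffD1]) (simp add: adj inner_add_right)
    show "adjoint B (r *\<^sub>R x) = r *\<^sub>R adjoint B x" for r x
      by (rule vector_eq_ldot[THEN iffD1]) (simp add: adj)
    show "norm (adjoint B y) \<le> norm y * K" for y
    proof (cases "adjoint B y = 0")
      case True then show ?thesis using K by simp
    next
      case False
      have "norm (adjoint B y) * norm (adjoint B y) = B (adjoint B y) \<bullet> y"
        by (simp add: adj[symmetric] adjoint_inner[OF assms] flip: power2_eq_square power2_norm_eq_inner)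
      also have "\<dots> \<le> norm (B (adjoint B y)) * norm y"
        by (rule norm_cauchy_schwarz)
      also have "\<dots> \<le> (norm (adjoint B y) * K) * norm y"
        using K(1) by (intro mult_right_mono) auto
      finally have "norm (adjoint B y) * norm (adjoint B y) \<le> norm (adjoint B y) * (norm y * K)"
        by (simp add: mult_ac)
      with False show ?thesis by simp
    qed
  qed
qed

section \<open>Curves in the level sets of a submersion\<close>

text \<open>
  For each small \<open>t\<close> the equation \<open>g (y0 + t w + S h) = g y0\<close> is solved for \<open>h\<close> by Banach's fixed
  point theorem: since \<open>g' y0\<close> composed with \<open>S\<close> is the identity, \<open>h \<mapsto> h - g (y0 + t w + S h)\<close>
  is a contraction with factor \<open>1/2\<close> near the origin. The same factor gives the estimate
  \<open>\<parallel>h\<parallel> \<le> 2 \<parallel>g' y (S h)\<parallel>\<close> for all \<open>y\<close> near \<open>y0\<close>. It serves in place of the inverse of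
  \<open>g' y \<circ> S\<close>: the derivative of the solution is again defined as a fixed point, and both
  differentiability and continuity of the derivative are read off after applying \<open>g' y \<circ> S\<close>.
  As \<open>g' y0 w = 0\<close>, the solution starts with velocity \<open>0\<close>, so the curve has initial velocity \<open>w\<close>;
  as the correction is a value of \<open>S\<close>, it stays in any subspace containing the range of \<open>S\<close>.
\<close>

lemma submersion_level_curve:
  fixes g :: "'a::real_normed_vector \<Rightarrow> 'y::banach"
    and g' :: "'a \<Rightarrow> 'a \<Rightarrow>\<^sub>L 'y" and S :: "'y \<Rightarrow>\<^sub>L 'a"
  assumes "open V" "y0 \<in> V"
    and der: "\<And>y. y \<in> V \<Longrightarrow> (g has_derivative g' y) (at y)"
    and cont: "continuous_on V g'"
    and right_inv: "g' y0 o\<^sub>L S = id_blinfun"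
    and w: "g' y0 w = 0"
  obtains \<epsilon> \<eta> \<eta>' where "\<epsilon> > 0"
    "\<forall>t. \<bar>t\<bar> < \<epsilon> \<longrightarrow> y0 + t *\<^sub>R w + S (\<eta> t) \<in> V \<and>
       g (y0 + t *\<^sub>R w + S (\<eta> t)) = g y0 \<and> (\<eta> has_vector_derivative \<eta>' t) (at t)"
    "continuous_on {-\<epsilon><..<\<epsilon>} \<eta>'"
    "\<eta> 0 = 0" "\<eta>' 0 = 0"
proof -
  define p where "p t h = y0 + t *\<^sub>R w + S h" for t h
  \<comment> \<open>\<open>\<kappa>\<close> is the variation of \<open>g'\<close> that keeps \<open>g' y \<circ> S\<close> within \<open>1/2\<close> of the identity.\<close>
  define \<kappa> where "\<kappa> = 1 / (2 * (norm S + 1))"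
  have \<kappa>: "0 < \<kappa>" "\<kappa> \<le> 1" "\<kappa> * norm S \<le> 1/2"
    unfolding \<kappa>_def using norm_ge_zero[of S]
    by (auto simp: divide_le_eq add_nonneg_pos)
  obtain r1 where r1: "r1 > 0" "cball y0 r1 \<subseteq> V"
    using \<open>open V\<close> \<open>y0 \<in> V\<close> open_contains_cball by blast
  obtain r2 where r2: "r2 > 0" "\<And>y. y \<in> V \<Longrightarrow> dist y y0 < r2 \<Longrightarrow> dist (g' y) (g' y0) < \<kappa>"
    using cont \<open>y0 \<in> V\<close> \<kappa>(1) unfolding continuous_on_iff by metis
  define r where "r = min r1 (r2 / 2)"
  have r: "r > 0" "cball y0 r \<subseteq> V" using r1 r2 by (auto simp: r_def)
  have near: "norm (g' y - g' y0) \<le> \<kappa>" if "y \<in> cball y0 r" for y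
    using r2(2)[of y] that r(2) r2(1) by (fastforce simp: r_def dist_norm norm_minus_commute)
  \<comment> \<open>Half of the radius \<open>r\<close> is left for the displacement \<open>S h\<close>, half for \<open>t w\<close>.\<close>
  define \<rho> where "\<rho> = r / (2 * (norm S + 1))"
  define \<delta> where "\<delta> = r / (2 * (norm w + 1))"
  have \<rho>: "\<rho> > 0" "norm S * \<rho> \<le> r / 2" and \<delta>: "\<delta> > 0" "\<delta> * norm w \<le> r / 2"
    using r(1) norm_ge_zero[of S] norm_ge_zero[of w] unfolding \<rho>_def \<delta>_def
    by (auto simp: field_simps add_nonneg_pos add_pos_nonneg)
  have p_in: "p t h \<in> cball y0 r" if "\<bar>t\<bar> \<le> \<delta>" "norm h \<le> \<rho>" for t h
  proof -
    have "norm (t *\<^sub>R w + S h) \<le> norm (t *\<^sub>R w) + norm (S h)" by (rule norm_triangle_ineq)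
    also have "norm (t *\<^sub>R w) \<le> \<delta> * norm w" using that by (simp add: mult_right_mono)
    also have "norm (S h) \<le> norm S * \<rho>"
      using norm_blinfun[of S h] mult_left_mono[OF that(2) norm_ge_zero[of S]] by linarith
    finally have "norm (t *\<^sub>R w + S h) \<le> r" using \<rho> \<delta> by linarith
    moreover have "dist y0 (p t h) = norm (t *\<^sub>R w + S h)"
      unfolding p_def dist_norm by (subst norm_minus_commute) (simp add: algebra_simps)
    ultimately show ?thesis by simp
  qed
  have GS: "norm ((g' y o\<^sub>L S) - id_blinfun) \<le> 1/2" if "y \<in> cball y0 r" for y
  proof -
    have "(g' y o\<^sub>L S) - id_blinfun = ((g' y - g' y0) o\<^sub>L S)"
      unfolding right_inv[symmetric]
      by (rule blinfun_eqI) (simp add: blinfun.diff_left)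
    then have "norm ((g' y o\<^sub>L S) - id_blinfun) \<le> norm (g' y - g' y0) * norm S"
      using norm_blinfun_compose by metis
    also have "\<dots> \<le> \<kappa> * norm S" using near[OF that] by (intro mult_right_mono) auto
    finally show ?thesis using \<kappa>(3) by linarith
  qed
  have half: "norm (h - g' y (S h)) \<le> 1/2 * norm h" if "y \<in> cball y0 r" for y h
  proof -
    have "norm (((g' y o\<^sub>L S) - id_blinfun) h) \<le> norm ((g' y o\<^sub>L S) - id_blinfun) * norm h"
      by (rule norm_blinfun)
    also have "\<dots> \<le> 1/2 * norm h" using GS[OF that] by (intro mult_right_mono) auto
    finally show ?thesis by (simp add: blinfun.diff_left norm_minus_commute)
  qed
  have coercive: "norm h \<le> 2 * norm (g' y (S h))" if "y \<in> cball y0 r" for y h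
    using half[OF that, of h] norm_triangle_ineq2[of h "g' y (S h)"] by linarith
  have contr: "norm ((h - g (p t h)) - (k - g (p t k))) \<le> 1/2 * norm (h - k)"
    if "\<bar>t\<bar> \<le> \<delta>" "norm h \<le> \<rho>" "norm k \<le> \<rho>" for t and h k :: 'y
  proof (rule differentiable_bound[where S="cball 0 \<rho>" and f'="\<lambda>h u. u - g' (p t h) (S u)"])
    fix h :: 'y assume h: "h \<in> cball 0 \<rho>"
    then have ph: "p t h \<in> cball y0 r" using p_in that(1) by simp
    have "(p t has_derivative S) (at h)"
      unfolding p_def by (auto intro!: derivative_eq_intros)
    moreover have "(g has_derivative g' (p t h)) (at (p t h))"
      using der ph r(2) by blast
    ultimately have "((\<lambda>h. g (p t h)) has_derivative (\<lambda>u. g' (p t h) (S u))) (at h)"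
      by (rule has_derivative_compose)
    then show "((\<lambda>h. h - g (p t h)) has_derivative (\<lambda>u. u - g' (p t h) (S u))) (at h within cball 0 \<rho>)"
      by (intro has_derivative_diff has_derivative_ident) (rule has_derivative_at_withinI)
    show "onorm (\<lambda>u. u - g' (p t h) (S u)) \<le> 1/2"
      by (rule onorm_bound) (use half[OF ph] in auto)
  qed (use that in auto)
  have solve_est: "norm (h - k) \<le> 2 * norm (g (p t h) - g (p t k))"
    if "\<bar>t\<bar> \<le> \<delta>" "norm h \<le> \<rho>" "norm k \<le> \<rho>" for t h k
  proof -
    have "h - k = ((h - g (p t h)) - (k - g (p t k))) + (g (p t h) - g (p t k))" by simp
    then have "norm (h - k) \<le> norm ((h - g (p t h)) - (k - g (p t k))) + norm (g (p t h) - g (p t k))"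
      by (metis norm_triangle_ineq)
    with contr[OF that] show ?thesis by linarith
  qed
  define C where "C = norm (g' y0) + 1"
  have Lip: "norm (g y - g z) \<le> C * norm (y - z)" if "y \<in> cball y0 r" "z \<in> cball y0 r" for y z
  proof (rule differentiable_bound[where S="cball y0 r" and f'="\<lambda>y. blinfun_apply (g' y)"])
    fix y assume y: "y \<in> cball y0 r"
    show "(g has_derivative g' y) (at y within cball y0 r)"
      using der y r(2) by (blast intro: has_derivative_at_withinI)
    show "onorm (g' y) \<le> C"
      using near[OF y] \<kappa>(2) norm_triangle_ineq2[of "g' y" "g' y0"]
      unfolding C_def norm_blinfun.rep_eq[symmetric] by linarith
  qed (use that in auto)
  define \<Lambda> where "\<Lambda> = 2 * (C * norm w)"
  have "C > 0" by (simp add: C_def add_nonneg_pos)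
  have Lip_t: "2 * norm (g (p s h) - g (p t h)) \<le> \<Lambda> * \<bar>s - t\<bar>"
    if "\<bar>s\<bar> \<le> \<delta>" "\<bar>t\<bar> \<le> \<delta>" "norm h \<le> \<rho>" for s t h
  proof -
    have "norm (g (p s h) - g (p t h)) \<le> C * norm (p s h - p t h)"
      using that by (intro Lip p_in)
    moreover have "p s h - p t h = (s - t) *\<^sub>R w" by (simp add: p_def algebra_simps)
    ultimately show ?thesis by (simp add: \<Lambda>_def mult_ac)
  qed
  have \<Lambda>: "\<Lambda> \<ge> 0" using \<open>C > 0\<close> by (simp add: \<Lambda>_def)
  \<comment> \<open>For \<open>\<bar>t\<bar> < \<epsilon>\<close> the fixed-point map moves \<open>0\<close> by at most \<open>\<rho> / 2\<close>, so it preserves \<open>cball 0 \<rho>\<close>.\<close>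
  define \<epsilon> where "\<epsilon> = min \<delta> (\<rho> / (\<Lambda> + 1))"
  have \<epsilon>: "\<epsilon> > 0" "\<epsilon> \<le> \<delta>" "\<Lambda> * \<epsilon> \<le> \<rho>"
  proof -
    show "\<epsilon> > 0" "\<epsilon> \<le> \<delta>" using \<rho>(1) \<delta>(1) \<Lambda> by (auto simp: \<epsilon>_def)
    have "\<Lambda> * \<epsilon> \<le> \<Lambda> * (\<rho> / (\<Lambda> + 1))" using \<Lambda> by (intro mult_left_mono) (auto simp: \<epsilon>_def)
    also have "\<dots> \<le> \<rho>" using \<Lambda> \<rho>(1) by (simp add: field_simps)
    finally show "\<Lambda> * \<epsilon> \<le> \<rho>" .
  qed
  have p00: "p 0 0 = y0" by (simp add: p_def blinfun.zero_right)
  have ex: "\<exists>h. norm h \<le> \<rho> \<and> g (p t h) = g y0" if t: "\<bar>t\<bar> < \<epsilon>" for t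
  proof -
    define T where "T h = h - (g (p t h) - g y0)" for h
    have t\<delta>: "\<bar>t\<bar> \<le> \<delta>" using t \<epsilon>(2) by linarith
    have T_contr: "norm (T h - T k) \<le> 1/2 * norm (h - k)" if "norm h \<le> \<rho>" "norm k \<le> \<rho>" for h k
      using contr[OF t\<delta> that] by (simp add: T_def algebra_simps)
    have "2 * norm (g (p t 0) - g (p 0 0)) \<le> \<Lambda> * \<bar>t - 0\<bar>"
      using t\<delta> \<delta>(1) \<rho>(1) by (intro Lip_t) auto
    also have "\<dots> \<le> \<Lambda> * \<epsilon>" using t \<Lambda> by (intro mult_left_mono) auto
    finally have T0: "norm (T 0) \<le> \<rho> / 2"
      using \<epsilon>(3) by (simp add: T_def p00 norm_minus_commute)
    have "\<exists>!h\<in>cball 0 \<rho>. T h = h"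
    proof (rule Banach_fix[where c="1/2"])
      show "complete (cball (0::'y) \<rho>)" by (simp add: complete_eq_closed)
      show "T ` cball 0 \<rho> \<subseteq> cball 0 \<rho>"
      proof safe
        fix h :: 'y assume "h \<in> cball 0 \<rho>"
        then have "norm h \<le> \<rho>" by simp
        then have "norm (T h - T 0) \<le> \<rho> / 2"
          using T_contr[of h 0] \<rho>(1) by simp
        then show "T h \<in> cball 0 \<rho>"
          using T0 norm_triangle_sub[of "T h" "T 0"] by simp
      qed
      show "dist (T h) (T k) \<le> 1/2 * dist h k" if "h \<in> cball 0 \<rho>" "k \<in> cball 0 \<rho>" for h k
        using T_contr that by (simp add: dist_norm)
    qed (use \<rho> in auto)
    then obtain h where h: "norm h \<le> \<rho>" "T h = h" by (metis mem_cball_0)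
    from h(2) have "g (p t h) = g y0" by (simp add: T_def)
    with h(1) show ?thesis by blast
  qed
  define \<eta> where "\<eta> t = (SOME h. norm h \<le> \<rho> \<and> g (p t h) = g y0)" for t
  have \<eta>: "norm (\<eta> t) \<le> \<rho>" "g (p t (\<eta> t)) = g y0" if "\<bar>t\<bar> < \<epsilon>" for t
    using someI_ex[OF ex[OF that]] by (simp_all add: \<eta>_def)
  define q where "q t = p t (\<eta> t)" for t
  have q_in: "q t \<in> cball y0 r" if "\<bar>t\<bar> < \<epsilon>" for t
    unfolding q_def using that \<epsilon>(2) \<eta>(1) by (intro p_in) auto
  have \<eta>0: "\<eta> 0 = 0"
    using solve_est[of 0 "\<eta> 0" 0] \<eta>[of 0] \<epsilon>(1) \<delta>(1) \<rho>(1) by (simp add: p00)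
  have \<eta>_Lip: "norm (\<eta> s - \<eta> t) \<le> \<Lambda> * \<bar>s - t\<bar>" if "\<bar>s\<bar> < \<epsilon>" "\<bar>t\<bar> < \<epsilon>" for s t
  proof -
    have "norm (\<eta> s - \<eta> t) \<le> 2 * norm (g (p s (\<eta> s)) - g (p s (\<eta> t)))"
      using that \<epsilon>(2) \<eta>(1) by (intro solve_est) auto
    also have "\<dots> = 2 * norm (g (p s (\<eta> t)) - g (p t (\<eta> t)))"
      using that \<eta>(2) by (simp add: norm_minus_commute)
    also have "\<dots> \<le> \<Lambda> * \<bar>s - t\<bar>" using that \<epsilon>(2) \<eta>(1) by (intro Lip_t) auto
    finally show ?thesis .
  qed
  have q_diff: "q s - q t = (s - t) *\<^sub>R w + S (\<eta> s - \<eta> t)" for s t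
    by (simp add: q_def p_def blinfun.diff_right algebra_simps)
  define Q where "Q = norm w + norm S * \<Lambda>"
  have "Q \<ge> 0" using \<Lambda> by (simp add: Q_def)
  have q_Lip: "norm (q s - q t) \<le> Q * \<bar>s - t\<bar>" if "\<bar>s\<bar> < \<epsilon>" "\<bar>t\<bar> < \<epsilon>" for s t
  proof -
    have "norm (q s - q t) \<le> norm ((s - t) *\<^sub>R w) + norm (S (\<eta> s - \<eta> t))"
      unfolding q_diff by (rule norm_triangle_ineq)
    also have "norm (S (\<eta> s - \<eta> t)) \<le> norm S * (\<Lambda> * \<bar>s - t\<bar>)"
      using norm_blinfun[of S "\<eta> s - \<eta> t"] mult_left_mono[OF \<eta>_Lip[OF that] norm_ge_zero[of S]]
      by linarith
    finally show ?thesis by (simp add: Q_def distrib_right distrib_left mult_ac)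
  qed
  \<comment> \<open>The linearised equation \<open>g' (q t) (w + S \<xi>) = 0\<close> determines the candidate for the derivative of \<open>\<eta>\<close>.\<close>
  have ex_\<xi>: "\<exists>\<xi>. g' (q t) (w + S \<xi>) = 0" if "\<bar>t\<bar> < \<epsilon>" for t
  proof -
    have "\<exists>!\<xi>. \<xi> - g' (q t) (w + S \<xi>) = \<xi>"
    proof (rule banach_fix_type[where c="1/2"])
      show "\<forall>x y. dist (x - g' (q t) (w + S x)) (y - g' (q t) (w + S y)) \<le> 1/2 * dist x y"
      proof (intro allI)
        fix x y
        have "(x - g' (q t) (w + S x)) - (y - g' (q t) (w + S y)) = (x - y) - g' (q t) (S (x - y))"
          by (simp add: blinfun.add_right blinfun.diff_right)
        then show "dist (x - g' (q t) (w + S x)) (y - g' (q t) (w + S y)) \<le> 1/2 * dist x y"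
          unfolding dist_norm using half[OF q_in[OF that], of "x - y"] by metis
      qed
    qed auto
    then show ?thesis by auto
  qed
  define \<xi> where "\<xi> t = (SOME \<xi>. g' (q t) (w + S \<xi>) = 0)" for t
  have \<xi>: "g' (q t) (w + S (\<xi> t)) = 0" if "\<bar>t\<bar> < \<epsilon>" for t
    using someI_ex[OF ex_\<xi>[OF that]] by (simp add: \<xi>_def)
  have \<eta>_der: "(\<eta> has_vector_derivative \<xi> t) (at t)" if t: "\<bar>t\<bar> < \<epsilon>" for t
    unfolding has_vector_derivative_def has_derivative_at_alt
  proof (intro conjI allI impI)
    show "bounded_linear (\<lambda>h. h *\<^sub>R \<xi> t)" by (rule bounded_linear_scaleR_left)
    fix e :: real assume "e > 0"
    define e' where "e' = e / (2 * (Q + 1))"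
    have e': "e' > 0" "2 * (e' * Q) \<le> e"
      using \<open>e > 0\<close> \<open>Q \<ge> 0\<close> by (auto simp: e'_def field_simps add_nonneg_pos)
    have "(g has_derivative g' (q t)) (at (q t))"
      using der q_in[OF t] r(2) by blast
    then obtain d where d: "d > 0" "\<And>y. norm (y - q t) < d \<Longrightarrow>
        norm (g y - g (q t) - g' (q t) (y - q t)) \<le> e' * norm (y - q t)"
      using e'(1) unfolding has_derivative_at_alt by blast
    define d' where "d' = min (\<epsilon> - \<bar>t\<bar>) (d / (Q + 1))"
    have d': "d' > 0" using t d(1) \<open>Q \<ge> 0\<close> by (simp add: d'_def)
    show "\<exists>d>0. \<forall>s. norm (s - t) < d \<longrightarrow>
        norm (\<eta> s - \<eta> t - (s - t) *\<^sub>R \<xi> t) \<le> e * norm (s - t)"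
    proof (intro exI[of _ d'] conjI allI impI d')
      fix s assume "norm (s - t) < d'"
      then have s: "\<bar>s\<bar> < \<epsilon>" "\<bar>s - t\<bar> < d / (Q + 1)" by (auto simp: d'_def)
      have "Q * \<bar>s - t\<bar> \<le> (Q + 1) * \<bar>s - t\<bar>" by (simp add: mult_right_mono)
      also have "\<dots> < d" using s(2) \<open>Q \<ge> 0\<close> by (simp add: field_simps)
      finally have "norm (q s - q t) < d" using q_Lip[OF s(1) t] by linarith
      \<comment> \<open>\<open>g\<close> takes the same value at \<open>q s\<close> and \<open>q t\<close>, so only the linear term remains.\<close>
      from d(2)[OF this] have "norm (g' (q t) (q s - q t)) \<le> e' * norm (q s - q t)"
        using \<eta>(2)[OF s(1)] \<eta>(2)[OF t] by (simp add: q_def)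
      also have "\<dots> \<le> e' * (Q * \<bar>s - t\<bar>)" using q_Lip[OF s(1) t] e'(1) by simp
      finally have 1: "norm (g' (q t) (q s - q t)) \<le> e' * (Q * \<bar>s - t\<bar>)" .
      have "g' (q t) (S (\<eta> s - \<eta> t - (s - t) *\<^sub>R \<xi> t))
          = g' (q t) (q s - q t) - (s - t) *\<^sub>R g' (q t) (w + S (\<xi> t))"
        unfolding q_diff
        by (simp add: blinfun.add_right blinfun.diff_right blinfun.scaleR_right algebra_simps)
      then have "g' (q t) (S (\<eta> s - \<eta> t - (s - t) *\<^sub>R \<xi> t)) = g' (q t) (q s - q t)"
        using \<xi>[OF t] by simp
      then have "norm (\<eta> s - \<eta> t - (s - t) *\<^sub>R \<xi> t) \<le> 2 * (e' * (Q * \<bar>s - t\<bar>))"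
        using coercive[OF q_in[OF t], of "\<eta> s - \<eta> t - (s - t) *\<^sub>R \<xi> t"] 1 by simp
      also have "\<dots> = 2 * (e' * Q) * \<bar>s - t\<bar>" by simp
      also have "\<dots> \<le> e * \<bar>s - t\<bar>" using e'(2) by (intro mult_right_mono) auto
      finally show "norm (\<eta> s - \<eta> t - (s - t) *\<^sub>R \<xi> t) \<le> e * norm (s - t)" by simp
    qed
  qed
  have \<xi>_cont: "continuous_on {-\<epsilon><..<\<epsilon>} \<xi>"
    unfolding continuous_on_def
  proof
    fix t assume "t \<in> {-\<epsilon><..<\<epsilon>}"
    then have t: "\<bar>t\<bar> < \<epsilon>" by auto
    have q_cont: "continuous_on {-\<epsilon><..<\<epsilon>} q"
      unfolding continuous_on_iff
    proof (intro ballI allI impI)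
      fix t e :: real assume "t \<in> {-\<epsilon><..<\<epsilon>}" "e > 0"
      show "\<exists>d>0. \<forall>s\<in>{-\<epsilon><..<\<epsilon>}. dist s t < d \<longrightarrow> dist (q s) (q t) < e"
      proof (intro exI[of _ "e / (Q + 1)"] conjI ballI impI)
        show "e / (Q + 1) > 0" using \<open>e > 0\<close> \<open>Q \<ge> 0\<close> by simp
        fix s assume s: "s \<in> {-\<epsilon><..<\<epsilon>}" "dist s t < e / (Q + 1)"
        have "Q * \<bar>s - t\<bar> \<le> (Q + 1) * \<bar>s - t\<bar>" by (simp add: mult_right_mono)
        also have "\<dots> < e" using s(2) \<open>Q \<ge> 0\<close> by (simp add: field_simps dist_norm)
        finally show "dist (q s) (q t) < e"
          using q_Lip[of s t] s(1) \<open>t \<in> {-\<epsilon><..<\<epsilon>}\<close> by (simp add: dist_norm abs_less_iff)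
      qed
    qed
    have "continuous_on {-\<epsilon><..<\<epsilon>} (\<lambda>s. g' (q s))"
      by (rule continuous_on_compose2[OF cont q_cont]) (use q_in r(2) in force)
    then have lim: "((\<lambda>s. g' (q s)) \<longlongrightarrow> g' (q t)) (at t within {-\<epsilon><..<\<epsilon>})"
      using \<open>t \<in> {-\<epsilon><..<\<epsilon>}\<close> by (simp add: continuous_on_def)
    have bound: "norm (\<xi> s - \<xi> t) \<le> 2 * norm ((g' (q s) - g' (q t)) (w + S (\<xi> t)))"
      if s: "\<bar>s\<bar> < \<epsilon>" for s
    proof -
      have "g' (q s) (S (\<xi> s - \<xi> t)) = g' (q s) (w + S (\<xi> s)) - g' (q s) (w + S (\<xi> t))"
        by (simp add: blinfun.add_right blinfun.diff_right)
      also have "\<dots> = - (g' (q s) - g' (q t)) (w + S (\<xi> t))"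
        using \<xi>[OF s] \<xi>[OF t] by (simp add: blinfun.diff_left)
      finally show ?thesis using coercive[OF q_in[OF s], of "\<xi> s - \<xi> t"] by simp
    qed
    have "((\<lambda>s. \<xi> s - \<xi> t) \<longlongrightarrow> 0) (at t within {-\<epsilon><..<\<epsilon>})"
    proof (rule Lim_null_comparison)
      show "\<forall>\<^sub>F s in at t within {-\<epsilon><..<\<epsilon>}.
          norm (\<xi> s - \<xi> t) \<le> 2 * norm ((g' (q s) - g' (q t)) (w + S (\<xi> t)))"
        using bound by (auto simp: eventually_at_filter abs_less_iff intro!: always_eventually)
      have "((\<lambda>s. 2 * norm ((g' (q s) - g' (q t)) (w + S (\<xi> t)))) \<longlongrightarrow>
          2 * norm ((g' (q t) - g' (q t)) (w + S (\<xi> t)))) (at t within {-\<epsilon><..<\<epsilon>})"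
        by (intro tendsto_intros lim)
      then show "((\<lambda>s. 2 * norm ((g' (q s) - g' (q t)) (w + S (\<xi> t)))) \<longlongrightarrow> 0) (at t within {-\<epsilon><..<\<epsilon>})"
        by simp
    qed
    then show "(\<xi> \<longlongrightarrow> \<xi> t) (at t within {-\<epsilon><..<\<epsilon>})" by (simp add: LIM_zero_iff)
  qed
  have "q 0 = y0" by (simp add: q_def \<eta>0 p00)
  moreover have "g' y0 (S h) = h" for h
    using right_inv by (metis blinfun_apply_blinfun_compose blinfun_apply_id_blinfun)
  ultimately have "\<xi> 0 = 0"
    using \<xi>[of 0] \<epsilon>(1) w by (simp add: blinfun.add_right)
  have curve: "\<forall>t. \<bar>t\<bar> < \<epsilon> \<longrightarrow> y0 + t *\<^sub>R w + S (\<eta> t) \<in> V \<and>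
      g (y0 + t *\<^sub>R w + S (\<eta> t)) = g y0 \<and> (\<eta> has_vector_derivative \<xi> t) (at t)"
    using q_in r(2) \<eta>(2) \<eta>_der unfolding q_def p_def by blast
  show ?thesis
    by (rule that[of \<epsilon> \<eta> \<xi>]) (fact \<epsilon>(1) curve \<xi>_cont \<eta>0 \<open>\<xi> 0 = 0\<close>)+
qed


section \<open>The tangent space of a linearly constrained submanifold\<close>

lemma has_vector_derivative_in_closed_subspace:
  fixes f :: "real \<Rightarrow> 'a::real_normed_vector"
  assumes der: "(f has_vector_derivative d) (at t)"
    and W: "subspace W" "closed W"
    and f: "f t \<in> W" "\<forall>\<^sub>F s in at t. f s \<in> W"
  shows "d \<in> W"
proof -
  have lim: "((\<lambda>s. (1 / (s - t)) *\<^sub>R (f s - f t)) \<longlongrightarrow> d) (at t)"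
  proof -
    have "((\<lambda>s. (f s - (f t + (s - t) *\<^sub>R d)) /\<^sub>R norm (s - t)) \<longlongrightarrow> 0) (at t)"
      using der by (simp add: has_vector_derivative_def has_derivative_at_within algebra_simps)
    then have "((\<lambda>s. norm ((f s - (f t + (s - t) *\<^sub>R d)) /\<^sub>R norm (s - t))) \<longlongrightarrow> 0) (at t)"
      by (rule tendsto_norm_zero)
    moreover have "norm ((f s - (f t + (s - t) *\<^sub>R d)) /\<^sub>R norm (s - t))
        = norm ((1 / (s - t)) *\<^sub>R (f s - f t) - d)" if "s \<noteq> t" for s
    proof -
      have "(1 / (s - t)) *\<^sub>R (f s - f t) - d = (1 / (s - t)) *\<^sub>R (f s - (f t + (s - t) *\<^sub>R d))"
        using that by (simp add: scaleR_diff_right scaleR_add_right)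
      then show ?thesis by (simp add: divide_inverse)
    qed
    ultimately have "((\<lambda>s. norm ((1 / (s - t)) *\<^sub>R (f s - f t) - d)) \<longlongrightarrow> 0) (at t)"
      by (subst Lim_cong_within[OF refl refl refl, of t UNIV _
            "\<lambda>s. norm ((f s - (f t + (s - t) *\<^sub>R d)) /\<^sub>R norm (s - t))"]) auto
    then show ?thesis
      using tendsto_norm_zero_iff LIM_zero_iff by blast
  qed
  have "\<forall>\<^sub>F s in at t. (1 / (s - t)) *\<^sub>R (f s - f t) \<in> W"
    using f(2) by eventually_elim (use W(1) f(1) in \<open>auto intro!: subspace_scale subspace_diff\<close>)
  then show ?thesis
    using Lim_in_closed_set[OF W(2) _ _ lim] by simp
qed

lemma tangent_space_mono: "M \<subseteq> N \<Longrightarrow> tangent_space M x \<subseteq> tangent_space N x"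
  unfolding tangent_space_def by blast

text \<open>
  The map \<open>R\<close> expresses that \<open>B\<close> restricted to \<open>T\<^sub>x M\<close> is onto with a bounded right inverse, so that
  the constraint is transversal to \<open>M\<close> at \<open>x\<close>.
\<close>

lemma tangent_space_constrained_set:
  fixes M :: "'e::{real_inner,banach} set" and B :: "'e \<Rightarrow> 'y::{real_inner,banach}"
  assumes M: "C2_embedded_submanifold M" and B: "bounded_linear B"
    and x: "x \<in> constrained_set M B c"
    and R: "bounded_linear R" "range R \<subseteq> tangent_space M x" "\<And>y. B (R y) = y"
  shows "tangent_space (constrained_set M B c) x = tangent_space M x \<inter> {v. B v = 0}"
proof (intro equalityI subsetI)
  fix v assume v: "v \<in> tangent_space (constrained_set M B c) x"
  then obtain \<gamma> \<gamma>' \<epsilon> where \<gamma>: "\<epsilon> > 0"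
      "\<forall>t\<in>{-\<epsilon><..<\<epsilon>}. \<gamma> t \<in> constrained_set M B c \<and> (\<gamma> has_vector_derivative \<gamma>' t) (at t)"
      "\<gamma>' 0 = v"
    unfolding tangent_space_def by blast
  have "((\<lambda>t. B (\<gamma> t)) has_vector_derivative B v) (at 0)"
    using \<gamma> by (intro bounded_linear.has_vector_derivative[OF B]) auto
  then have "((\<lambda>t. c) has_vector_derivative B v) (at 0)"
    by (rule has_vector_derivative_transform_within_open[where S="{-\<epsilon><..<\<epsilon>}"])
       (use \<gamma> in \<open>auto simp: constrained_set_def\<close>)
  then have "B v = 0"
    using vector_derivative_unique_at has_vector_derivative_const by blast
  moreover have "v \<in> tangent_space M x"
    using tangent_space_mono[of "constrained_set M B c" M x] v by (auto simp: constrained_set_def)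
  ultimately show "v \<in> tangent_space M x \<inter> {v. B v = 0}" by simp
next
  fix v assume "v \<in> tangent_space M x \<inter> {v. B v = 0}"
  then have v: "v \<in> tangent_space M x" "B v = 0" by auto
  have xM: "x \<in> M" "B x = c" using x by (auto simp: constrained_set_def)
  obtain U V :: "'e set" and \<phi> \<psi> W where chart: "open U" "x \<in> U" "open V"
      "homeomorphism U V \<phi> \<psi>" "C2_on U \<phi>" "C2_on V \<psi>" "subspace W" "closed W"
      "\<phi> ` (U \<inter> M) = V \<inter> W"
    using bspec[OF M[unfolded C2_embedded_submanifold_def] xM(1)]
    by (elim exE conjE) (rule that; assumption)
  obtain \<phi>' :: "'e \<Rightarrow> 'e \<Rightarrow>\<^sub>L 'e" where \<phi>': "\<And>u. u \<in> U \<Longrightarrow> (\<phi> has_derivative \<phi>' u) (at u)"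
    using chart(5) unfolding C2_on_def by blast
  obtain \<psi>' :: "'e \<Rightarrow> 'e \<Rightarrow>\<^sub>L 'e" and \<psi>'' where \<psi>': "\<And>y. y \<in> V \<Longrightarrow> (\<psi> has_derivative \<psi>' y) (at y)"
      "\<And>y. y \<in> V \<Longrightarrow> (\<psi>' has_derivative \<psi>'' y) (at y)"
    using chart(6) unfolding C2_on_def by (elim conjE exE) (rule that; erule bspec; assumption)
  have \<psi>'_cont: "continuous_on V \<psi>'"
    by (rule has_derivative_continuous_on[OF has_derivative_at_withinI[OF \<psi>'(2)]])
  have \<psi>\<phi>: "\<psi> (\<phi> u) = u" if "u \<in> U" for u
    using chart(4) that by (rule homeomorphism_apply1)
  define y0 where "y0 = \<phi> x"
  have y0: "y0 \<in> V" "y0 \<in> W" "\<psi> y0 = x"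
    using chart(2,9) xM(1) \<psi>\<phi> by (auto simp: y0_def)
  \<comment> \<open>Differentiating \<open>\<psi> (\<phi> u) = u\<close>.\<close>
  have inverse: "\<psi>' y0 (\<phi>' x u) = u" for u
  proof -
    have "((\<lambda>u. \<psi> (\<phi> u)) has_derivative (\<lambda>u. \<psi>' y0 (\<phi>' x u))) (at x)"
      by (rule has_derivative_compose[OF \<phi>'[OF chart(2)] \<psi>'(1)[OF y0(1), unfolded y0_def],
            folded y0_def])
    then have "((\<lambda>u. u) has_derivative (\<lambda>u. \<psi>' y0 (\<phi>' x u))) (at x)"
      by (rule has_derivative_transform_within_open[OF _ chart(1,2)]) (rule \<psi>\<phi>)
    then have "(\<lambda>u. \<psi>' y0 (\<phi>' x u)) = (\<lambda>u. u)"
      using has_derivative_unique has_derivative_ident by blast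
    then show ?thesis by meson
  qed
  \<comment> \<open>A curve in \<open>M\<close> is carried into \<open>W\<close>, and a velocity of a curve in \<open>W\<close> is in \<open>W\<close>.\<close>
  have flat: "\<phi>' x u \<in> W" if u: "u \<in> tangent_space M x" for u
  proof -
    obtain \<gamma> \<gamma>' \<epsilon> where \<gamma>: "\<epsilon> > 0"
        "\<forall>t\<in>{-\<epsilon><..<\<epsilon>}. \<gamma> t \<in> M \<and> (\<gamma> has_vector_derivative \<gamma>' t) (at t)"
        "\<gamma> 0 = x" "\<gamma>' 0 = u"
      using u unfolding tangent_space_def by blast
    have \<gamma>0: "(\<gamma> has_vector_derivative u) (at 0)" using \<gamma> by force
    then have "((\<lambda>t. \<phi> (\<gamma> t)) has_derivative (\<lambda>t. \<phi>' x (t *\<^sub>R u))) (at 0)"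
      unfolding has_vector_derivative_def
      by (rule has_derivative_compose) (use \<phi>' chart(2) \<gamma>(3) in simp)
    then have "((\<lambda>t. \<phi> (\<gamma> t)) has_vector_derivative \<phi>' x u) (at 0)"
      by (simp add: has_vector_derivative_def blinfun.scaleR_right)
    then show ?thesis
    proof (rule has_vector_derivative_in_closed_subspace[OF _ chart(7,8)])
      show "\<phi> (\<gamma> 0) \<in> W" using y0(2) \<gamma>(3) by (simp add: y0_def)
      have "(\<gamma> \<longlongrightarrow> x) (at 0)"
        using has_vector_derivative_continuous[OF \<gamma>0] \<gamma>(3) by (simp add: isCont_def)
      then have "\<forall>\<^sub>F t in at 0. \<gamma> t \<in> U" using chart(1,2) by (rule topological_tendstoD)
      moreover have "\<forall>\<^sub>F t in at 0. t \<in> {-\<epsilon><..<\<epsilon>}"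
        using \<gamma>(1) by (intro eventually_at_in_open') auto
      ultimately show "\<forall>\<^sub>F t in at 0. \<phi> (\<gamma> t) \<in> W"
        by eventually_elim (use \<gamma>(2) chart(9) in blast)
    qed
  qed
  \<comment> \<open>The constraint, its right inverse and the direction \<open>v\<close>, all read in the chart.\<close>
  define S where "S = \<phi>' x o\<^sub>L Blinfun R"
  define g' where "g' y = Blinfun B o\<^sub>L \<psi>' y" for y
  define w where "w = \<phi>' x v"
  have S: "S h = \<phi>' x (R h)" for h by (simp add: S_def bounded_linear_Blinfun_apply R(1))
  have g': "g' y u = B (\<psi>' y u)" for y u by (simp add: g'_def bounded_linear_Blinfun_apply B)
  have right_inv: "g' y0 o\<^sub>L S = id_blinfun"
    by (rule blinfun_eqI) (simp add: S g' inverse R(3))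
  have g_der: "((\<lambda>y. B (\<psi> y)) has_derivative g' y) (at y)" if "y \<in> V" for y
    using bounded_linear.has_derivative[OF B \<psi>'(1)[OF that]] by (simp add: g'[abs_def])
  have g'_cont: "continuous_on V g'"
    unfolding g'_def by (intro continuous_intros \<psi>'_cont)
  have w_ker: "g' y0 w = 0" by (simp add: g' w_def inverse v(2))
  obtain \<epsilon> \<eta> \<eta>' where \<epsilon>: "\<epsilon> > 0"
    and \<eta>: "\<forall>t. \<bar>t\<bar> < \<epsilon> \<longrightarrow> y0 + t *\<^sub>R w + S (\<eta> t) \<in> V \<and>
      B (\<psi> (y0 + t *\<^sub>R w + S (\<eta> t))) = B (\<psi> y0) \<and> (\<eta> has_vector_derivative \<eta>' t) (at t)"
    and \<eta>'_cont: "continuous_on {-\<epsilon><..<\<epsilon>} \<eta>'" and \<eta>_start: "\<eta> 0 = 0" "\<eta>' 0 = 0"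
    by (rule submersion_level_curve[OF chart(3) y0(1) g_der g'_cont right_inv w_ker])
  have \<eta>_der: "(\<eta> has_vector_derivative \<eta>' t) (at t)" if "\<bar>t\<bar> < \<epsilon>" for t
    using \<eta> that by blast
  define q where "q t = y0 + t *\<^sub>R w + S (\<eta> t)" for t
  define \<gamma>' where "\<gamma>' t = \<psi>' (q t) (w + S (\<eta>' t))" for t
  have q_der: "(q has_vector_derivative (w + S (\<eta>' t))) (at t)" if "\<bar>t\<bar> < \<epsilon>" for t
    unfolding q_def
    by (rule derivative_eq_intros bounded_linear.has_vector_derivative[OF blinfun.bounded_linear_right]
          \<eta>_der[OF that] refl | simp)+
  have q_cont: "continuous_on {-\<epsilon><..<\<epsilon>} q"
    by (intro continuous_at_imp_continuous_on ballI has_vector_derivative_continuous[OF q_der]) auto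
  have q_V: "q t \<in> V" if "\<bar>t\<bar> < \<epsilon>" for t using \<eta> that by (simp add: q_def)
  \<comment> \<open>The base point, the direction and the correction all lie in \<open>W\<close>; hence \<open>\<psi> (q t) \<in> M\<close>.\<close>
  have q_W: "q t \<in> W" for t
    unfolding q_def w_def S using R(2) v(1)
    by (intro subspace_add[OF chart(7)] subspace_scale[OF chart(7)] flat y0) auto
  have in_M: "\<psi> (q t) \<in> M" if t: "\<bar>t\<bar> < \<epsilon>" for t
  proof -
    have "q t \<in> \<phi> ` (U \<inter> M)" using q_V[OF t] q_W chart(9) by blast
    then show ?thesis using \<psi>\<phi> by auto
  qed
  have der: "((\<lambda>t. \<psi> (q t)) has_vector_derivative \<gamma>' t) (at t)" if t: "\<bar>t\<bar> < \<epsilon>" for t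
    using has_derivative_compose[OF q_der[OF t, unfolded has_vector_derivative_def]
        \<psi>'(1)[OF q_V[OF t]]]
    by (simp add: has_vector_derivative_def \<gamma>'_def blinfun.scaleR_right)
  have "continuous_on {-\<epsilon><..<\<epsilon>} (\<lambda>t. \<psi>' (q t))"
    by (rule continuous_on_compose2[OF \<psi>'_cont q_cont]) (use q_V in auto)
  then have cont: "continuous_on {-\<epsilon><..<\<epsilon>} \<gamma>'"
    unfolding \<gamma>'_def by (intro continuous_intros \<eta>'_cont)
  have start: "\<psi> (q 0) = x" "\<gamma>' 0 = v"
    using \<eta>_start y0(3) by (simp_all add: q_def \<gamma>'_def blinfun.zero_right w_def inverse)
  show "v \<in> tangent_space (constrained_set M B c) x"
    unfolding tangent_space_def
  proof (intro CollectI exI conjI ballI)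
    fix t assume "t \<in> {-\<epsilon><..<\<epsilon>}"
    then have t: "\<bar>t\<bar> < \<epsilon>" by auto
    show "\<psi> (q t) \<in> constrained_set M B c"
      using in_M[OF t] \<eta> t y0(3) xM(2) by (simp add: constrained_set_def q_def)
    show "((\<lambda>t. \<psi> (q t)) has_vector_derivative \<gamma>' t) (at t)" by (rule der[OF t])
  qed (use \<epsilon> cont start in auto)
qed

section \<open>The constrained projection\<close>

theorem proposition3p2:
  fixes M :: "'e::{real_inner,banach} set"
    and B :: "'e \<Rightarrow> 'y::{real_inner,banach}"
    and c :: 'y
    and P :: "'e \<Rightarrow> 'e \<Rightarrow> 'e"
  assumes "C2_embedded_submanifold M"
    and "bounded_linear B"
    and "surj B"
    and "constrained_set M B c \<noteq> {}"
    and "\<And>x. x \<in> M \<Longrightarrow> bounded_linear (P x)"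
    and "\<And>x. x \<in> M \<Longrightarrow> projection_onto (P x) (tangent_space M x)"
    and "\<And>x. x \<in> constrained_set M B c \<Longrightarrow> invertible_operator (L_op B (P x))"
  shows "\<forall>x \<in> constrained_set M B c.
           projection_onto (constrained_projection B (P x))
             (tangent_space (constrained_set M B c) x) \<and>
           (\<forall>u. constrained_projection B (P x) u \<in> tangent_space (constrained_set M B c) x) \<and>
           (\<forall>v \<in> tangent_space (constrained_set M B c) x. constrained_projection B (P x) v = v) \<and>
           (orthogonal_projection_onto (P x) (tangent_space M x) \<longrightarrow>
            orthogonal_projection_onto (constrained_projection B (P x))
              (tangent_space (constrained_set M B c) x))"
proof
  fix x assume x: "x \<in> constrained_set M B c"
  then have xM: "x \<in> M" by (simp add: constrained_set_def)
  let ?L = "L_op B (P x)" and ?T = "tangent_space M x"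
    and ?TB = "tangent_space (constrained_set M B c) x" and ?F = "constrained_projection B (P x)"
  have P: "subspace ?T" "closed ?T" "range (P x) = ?T" "\<And>u. P x (P x u) = P x u"
    using assms(6)[OF xM] by (auto simp: projection_onto_def fun_eq_iff)
  have P_id: "P x v = v" if "v \<in> ?T" for v using P(3,4) that by (metis imageE)
  obtain K where K: "bounded_linear K" "K \<circ> ?L = id" "?L \<circ> K = id"
    using assms(7)[OF x] unfolding invertible_operator_def by blast
  have inv_L: "inv ?L = K" by (rule inv_unique_comp[OF K(3,2)])
  define R where "R y = P x (adjoint B (K y))" for y
  have R: "bounded_linear R"
    unfolding R_def
    by (intro bounded_linear_compose[OF assms(5)[OF xM]]
        bounded_linear_compose[OF bounded_linear_adjoint[OF assms(2)]] K(1))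
  have R_T: "R y \<in> ?T" for y using P(3) by (auto simp: R_def)
  have BR: "B (R y) = y" for y using K(3) by (simp add: R_def L_op_def fun_eq_iff)
  have TB: "?TB = ?T \<inter> {v. B v = 0}"
    using R_T BR by (intro tangent_space_constrained_set[OF assms(1,2) x R]) auto
  have F: "?F u = P x u - R (B (P x u))" for u
    by (simp add: constrained_projection_def inv_L R_def)
  interpret B: bounded_linear B by fact
  interpret R: bounded_linear R by fact
  interpret Px: bounded_linear "P x" using assms(5) xM .
  have F_in: "?F u \<in> ?TB" for u
    using P(3) R_T subspace_diff[OF P(1)] by (auto simp: TB F B.diff BR)
  have F_id: "?F v = v" if "v \<in> ?TB" for v
    using that P_id by (simp add: TB F R.zero)
  have lin: "linear ?F"
    by (rule linearI) (simp_all add: F Px.add Px.scaleR B.add B.scaleR R.add R.scaleR algebra_simps)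
  have sub: "subspace ?TB"
    unfolding TB using P(1)
    by (intro subspace_inter) (auto simp: subspace_def B.zero B.add B.scaleR)
  have clo: "closed ?TB"
    unfolding TB by (intro closed_Int P(2) closed_Collect_eq continuous_intros
        B.continuous_on continuous_on_id)
  have proj: "projection_onto ?F ?TB"
    unfolding projection_onto_def
  proof (intro conjI sub clo lin)
    show "range ?F = ?TB" using F_in F_id by (metis (no_types) image_subsetI rangeI subsetI subset_antisym)
    show "?F \<circ> ?F = ?F" using F_in F_id by (simp add: fun_eq_iff)
  qed
  have orth: "orthogonal (u - ?F u) s"
    if "orthogonal_projection_onto (P x) ?T" "s \<in> ?TB" for u s
  proof -
    have s: "s \<in> ?T" "B s = 0" using that(2) by (auto simp: TB)
    have res: "(z - P x z) \<bullet> s = 0" for z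
      using that(1) s(1) by (simp add: orthogonal_projection_onto_def orthogonal_def)
    define z where "z = adjoint B (K (B (P x u)))"
    have "z \<bullet> s = 0"
      using adjoint_inner[OF assms(2), of s "K (B (P x u))"] s(2) by (simp add: z_def inner_commute)
    then have "P x z \<bullet> s = 0" using res[of z] by (simp add: inner_diff_left)
    moreover have "u - ?F u = (u - P x u) + P x z" by (simp add: F R_def z_def)
    ultimately show ?thesis using res[of u] by (simp only: orthogonal_def inner_add_left)
  qed
  show "projection_onto ?F ?TB \<and> (\<forall>u. ?F u \<in> ?TB) \<and> (\<forall>v \<in> ?TB. ?F v = v) \<and>
      (orthogonal_projection_onto (P x) ?T \<longrightarrow> orthogonal_projection_onto ?F ?TB)"
    using proj F_in F_id orth by (simp add: orthogonal_projection_onto_def)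
qed

end
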